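(* Let $(X,Y)$ be bivariate normal with standard normal marginals $X$ and $Y$ and correlation $\rho=\rho(X,Y)$. Then (i) $\mathcal R(X,Y)\le|\rho|$; (ii) $$\mathcal R^2(X,Y)=\frac{\rho\arcsin\rho+\sqrt{1-\rho^2}-\rho\arcsin(\rho/2)-\sqrt{4-\rho^2}+1}{1+\pi/3-\sqrt3};$$ (iii) $$\inf_{\rho\ne0}\frac{\mathcal R(X,Y)}{|\rho|}=\lim_{\rho\to0}\frac{\mathcal R(X,Y)}{|\rho|}=\frac{1}{2(1+\pi/3-\sqrt3)^{1/2}}\approx 0.89066,$$ where $\mathcal R(X,Y)$ is regarded as a function of $\rho\in[-1,1]$.
   Context: For real random variables $X,Y$ with finite first moments, with characteristic functions $f_X,f_Y$ and joint characteristic function $f_{X,Y}(t,s)=Ee^{itX+isY}$, the distance covariance $\mathcal V(X,Y)\ge0$ is defined by $$\mathcal V^2(X,Y)=\frac1{\pi^2}\int_{\mathbb R^2}\frac{|f_{X,Y}(t,s)-f_X(t)f_Y(s)|^2}{t^2s^2}\,dt\,ds,$$ and $\mathcal V^2(X)=\mathcal V^2(X,X)$, where $f_{X,X}(t,s)=f_X(t+s)$. The distance correlation $\mathcal R(X,Y)\ge0$ is defined by $\mathcal R^2(X,Y)=\mathcal V^2(X,Y)/\sqrt{\mathcal V^2(X)\mathcal V^2(Y)}$ if $\mathcal V^2(X)\mathcal V^2(Y)>0$, and $\mathcal R^2(X,Y)=0$ otherwise. *)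

theory Defs
  imports "HOL-Probability.Probability"
begin

section \<open>Distance covariance and distance correlation\<close>

definition joint_char ::
    "'a measure \<Rightarrow> ('a \<Rightarrow> real) \<Rightarrow> ('a \<Rightarrow> real) \<Rightarrow> real \<Rightarrow> real \<Rightarrow> complex" where
  "joint_char M X Y t s = (LINT \<omega>|M. iexp (t * X \<omega> + s * Y \<omega>))"

text \<open>
  The integrand is \<open>0\<close> on the two coordinate axes because of \<open>x / 0 = 0\<close>; they form a null set.
  Only meaningful for \<open>X\<close> and \<open>Y\<close> with finite first moments, for which the integrand is
  integrable.
\<close>
definition dcov_sq :: "'a measure \<Rightarrow> ('a \<Rightarrow> real) \<Rightarrow> ('a \<Rightarrow> real) \<Rightarrow> real" where
  "dcov_sq M X Y =
     1 / pi\<^sup>2 * (LINT (t, s)|(lborel :: (real \<times> real) measure).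
       (cmod (joint_char M X Y t s - char (distr M borel X) t * char (distr M borel Y) s))\<^sup>2
         / (t\<^sup>2 * s\<^sup>2))"

definition dcor_sq :: "'a measure \<Rightarrow> ('a \<Rightarrow> real) \<Rightarrow> ('a \<Rightarrow> real) \<Rightarrow> real" where
  "dcor_sq M X Y =
     (if dcov_sq M X X * dcov_sq M Y Y > 0
      then dcov_sq M X Y / sqrt (dcov_sq M X X * dcov_sq M Y Y) else 0)"

definition dcor :: "'a measure \<Rightarrow> ('a \<Rightarrow> real) \<Rightarrow> ('a \<Rightarrow> real) \<Rightarrow> real" where
  "dcor M X Y = sqrt (dcor_sq M X Y)"

section \<open>Correlation and bivariate normal pairs\<close>

definition correlation :: "'a measure \<Rightarrow> ('a \<Rightarrow> real) \<Rightarrow> ('a \<Rightarrow> real) \<Rightarrow> real" where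
  "correlation M X Y =
     (LINT \<omega>|M. (X \<omega> - (LINT \<omega>|M. X \<omega>)) * (Y \<omega> - (LINT \<omega>|M. Y \<omega>)))
       / sqrt ((LINT \<omega>|M. (X \<omega> - (LINT \<omega>|M. X \<omega>))\<^sup>2) * (LINT \<omega>|M. (Y \<omega> - (LINT \<omega>|M. Y \<omega>))\<^sup>2))"

text \<open>Mean \<open>\<mu>\<close> and standard deviation \<open>\<sigma>\<close>; the case \<open>\<sigma> = 0\<close> is the point mass at \<open>\<mu>\<close>.\<close>
definition normal_law :: "real \<Rightarrow> real \<Rightarrow> real measure" where
  "normal_law \<mu> \<sigma> =
     (if \<sigma> = 0 then return borel \<mu> else density lborel (\<lambda>x. ennreal (normal_density \<mu> \<sigma> x)))"

text \<open>
  Joint normality: every linear combination is normal. Degenerate laws are admitted, as they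
  must be for correlations \<open>\<plusminus>1\<close>.
\<close>
definition bivariate_normal :: "'a measure \<Rightarrow> ('a \<Rightarrow> real) \<Rightarrow> ('a \<Rightarrow> real) \<Rightarrow> bool" where
  "bivariate_normal M X Y \<longleftrightarrow>
     prob_space M \<and> X \<in> borel_measurable M \<and> Y \<in> borel_measurable M \<and>
     (\<forall>a b. \<exists>\<mu> \<sigma>. 0 \<le> \<sigma> \<and> distr M borel (\<lambda>\<omega>. a * X \<omega> + b * Y \<omega>) = normal_law \<mu> \<sigma>)"

definition std_bivariate_normal ::
    "'a measure \<Rightarrow> ('a \<Rightarrow> real) \<Rightarrow> ('a \<Rightarrow> real) \<Rightarrow> real \<Rightarrow> bool" where
  "std_bivariate_normal M X Y \<rho> \<longleftrightarrow>
     bivariate_normal M X Y \<and>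
     distr M borel X = std_normal_distribution \<and>
     distr M borel Y = std_normal_distribution \<and>
     correlation M X Y = \<rho>"

section \<open>A pair for each correlation\<close>

text \<open>
  The law of \<open>(U, \<rho> U + sqrt (1 - \<rho>\<^sup>2) V)\<close> for independent standard normal \<open>U\<close>, \<open>V\<close>. The lemma
  \<open>std_bivariate_normal_bvn_law\<close> below shows that its coordinates form a bivariate normal pair
  with standard normal marginals and correlation \<open>\<rho>\<close>.
\<close>
definition bvn_law :: "real \<Rightarrow> (real \<times> real) measure" where
  "bvn_law \<rho> = distr (std_normal_distribution \<Otimes>\<^sub>M std_normal_distribution) borel
     (\<lambda>(u, v). (u, \<rho> * u + sqrt (1 - \<rho>\<^sup>2) * v))"

definition normal_dcor :: "real \<Rightarrow> real" where
  "normal_dcor \<rho> = dcor (bvn_law \<rho>) fst snd"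

lemma normal_law_eq_distr:
  assumes "0 \<le> \<sigma>"
  shows "normal_law \<mu> \<sigma> = distr std_normal_distribution borel (\<lambda>x. \<mu> + \<sigma> * x)"
proof -
  interpret S: prob_space std_normal_distribution
    using real_dist_normal_dist by (simp add: real_distribution_def)
  show ?thesis
  proof (cases "\<sigma> = 0")
    case True
    then show ?thesis
      by (simp add: normal_law_def S.distr_const)
  next
    case False
    have d: "distributed std_normal_distribution lborel (\<lambda>x. x) (\<lambda>x. ennreal (std_normal_density x))"
      by (auto simp: distributed_def intro!: distr_id2)
    have "distributed std_normal_distribution lborel (\<lambda>x. \<mu> + \<sigma> * x)
        (\<lambda>x. ennreal (normal_density (\<mu> + \<sigma> * 0) (\<bar>\<sigma>\<bar> * 1) x))"
      by (rule S.normal_density_affine[OF d]) (use False in auto)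
    then have "distr std_normal_distribution lborel (\<lambda>x. \<mu> + \<sigma> * x)
        = density lborel (\<lambda>x. ennreal (normal_density \<mu> \<sigma> x))"
      using assms by (simp add: distributed_def)
    moreover have "distr std_normal_distribution lborel (\<lambda>x. \<mu> + \<sigma> * x)
        = distr std_normal_distribution borel (\<lambda>x. \<mu> + \<sigma> * x)"
      by (rule distr_cong) auto
    ultimately show ?thesis
      using False by (simp add: normal_law_def)
  qed
qed

lemma char_normal_law:
  assumes "0 \<le> \<sigma>"
  shows "char (normal_law 0 \<sigma>) t = complex_of_real (exp (- (\<sigma> * t)\<^sup>2 / 2))"
proof -
  have "char (normal_law 0 \<sigma>) t = char std_normal_distribution (t * \<sigma>)"
    unfolding normal_law_eq_distr[OF assms] char_def
    by (subst integral_distr) (auto simp: mult_ac)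
  then show ?thesis
    by (simp add: char_std_normal_distribution mult.commute)
qed

lemma distr_indep_std_normal:
  "distr (std_normal_distribution \<Otimes>\<^sub>M std_normal_distribution) borel (\<lambda>(u, v). a * u + b * v)
     = normal_law 0 (sqrt (a\<^sup>2 + b\<^sup>2))" (is "distr ?P borel ?f = ?N")
proof -
  let ?S = std_normal_distribution
  interpret S: prob_space ?S
    using real_dist_normal_dist by (simp add: real_distribution_def)
  interpret P: pair_prob_space ?S ?S ..
  have m: "?f \<in> borel_measurable ?P"
    by measurable
  have "char (distr ?P borel ?f) t = char ?N t" for t
  proof -
    have int: "integrable ?S (\<lambda>x. iexp (c * x))" for c
      by (rule S.integrable_iexp) auto
    have "char (distr ?P borel ?f) t = (LINT z|?P. iexp (t * ?f z))"
      unfolding char_def by (subst integral_distr) (use m in auto)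
    also have "\<dots> = (LINT z|?P. iexp (t * a * fst z) * iexp (t * b * snd z))"
      by (intro Bochner_Integration.integral_cong refl)
         (auto simp: exp_add [symmetric] algebra_simps split: prod.splits)
    also have "\<dots> = (LINT u|?S. LINT v|?S. iexp (t * a * u) * iexp (t * b * v))"
    proof -
      have "integrable ?P (\<lambda>z. iexp (t * a * fst z) * iexp (t * b * snd z))"
        by (rule P.P.integrable_const_bound[where B = 1])
           (auto simp: norm_mult measurable_split_conv)
      from P.integral_fst'[OF this] show ?thesis by simp
    qed
    also have "\<dots> = char ?S (t * a) * char ?S (t * b)"
      unfolding char_def by (simp add: int)
    also have "\<dots> = char ?N t"
      by (subst char_normal_law)
         (auto simp: char_std_normal_distribution exp_add [symmetric] power_mult_distrib
           field_simps simp flip: of_real_mult)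
    finally show ?thesis .
  qed
  moreover have "real_distribution (distr ?P borel ?f)"
    using m by (auto simp: real_distribution_def real_distribution_axioms_def
      intro!: P.P.prob_space_distr)
  moreover have "real_distribution ?N"
    by (subst normal_law_eq_distr) (auto simp: real_distribution_def real_distribution_axioms_def
      intro!: S.prob_space_distr)
  ultimately show ?thesis
    by (intro Levy_uniqueness) auto
qed

lemma std_bivariate_normal_bvn_law:
  assumes "\<rho> \<in> {-1..1}"
  shows "std_bivariate_normal (bvn_law \<rho>) fst snd \<rho>"
proof -
  let ?S = std_normal_distribution
  let ?P = "?S \<Otimes>\<^sub>M ?S"
  define c where "c = sqrt (1 - \<rho>\<^sup>2)"
  define g where "g = (\<lambda>(u, v). (u :: real, \<rho> * u + c * v))"
  interpret S: prob_space ?S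
    using real_dist_normal_dist by (simp add: real_distribution_def)
  interpret P: pair_prob_space ?S ?S ..
  have c2: "\<rho>\<^sup>2 + c\<^sup>2 = 1"
  proof -
    have "\<rho>\<^sup>2 \<le> 1"
      using assms by (simp add: abs_square_le_1 abs_le_iff)
    then show ?thesis
      by (simp add: c_def)
  qed
  have law: "bvn_law \<rho> = distr ?P borel g"
    by (simp add: bvn_law_def g_def c_def)
  have gm: "g \<in> ?P \<rightarrow>\<^sub>M borel"
    unfolding g_def borel_prod [symmetric] by measurable
  have comb: "distr (bvn_law \<rho>) borel (\<lambda>\<omega>. a * fst \<omega> + b * snd \<omega>)
      = normal_law 0 (sqrt ((a + b * \<rho>)\<^sup>2 + (b * c)\<^sup>2))" for a b
  proof -
    have "distr (bvn_law \<rho>) borel (\<lambda>\<omega>. a * fst \<omega> + b * snd \<omega>)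
        = distr ?P borel ((\<lambda>\<omega>. a * fst \<omega> + b * snd \<omega>) \<circ> g)"
      unfolding law by (rule distr_distr) (use gm in \<open>auto simp: borel_prod [symmetric]\<close>)
    also have "(\<lambda>\<omega>. a * fst \<omega> + b * snd \<omega>) \<circ> g = (\<lambda>(u, v). (a + b * \<rho>) * u + (b * c) * v)"
      by (auto simp: g_def fun_eq_iff algebra_simps)
    finally show ?thesis
      by (simp add: distr_indep_std_normal)
  qed
  have std: "normal_law 0 1 = ?S"
    by (simp add: normal_law_def)
  have X: "distr (bvn_law \<rho>) borel fst = ?S"
    using comb[of 1 0] by (simp add: std)
  have Y: "distr (bvn_law \<rho>) borel snd = ?S"
    using comb[of 0 1] by (simp add: std c2)
  have m [measurable]: "fst \<in> borel_measurable (bvn_law \<rho>)" "snd \<in> borel_measurable (bvn_law \<rho>)"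
    by (auto simp: law borel_prod [symmetric])
  have "prob_space (bvn_law \<rho>)"
    unfolding law by (rule P.P.prob_space_distr[OF gm])
  then have bn: "bivariate_normal (bvn_law \<rho>) fst snd"
    unfolding bivariate_normal_def using m comb by (metis real_sqrt_ge_zero sum_power2_ge_zero)
  have i1: "integrable ?S (\<lambda>x. x)" and i2: "integrable ?S (\<lambda>x. x\<^sup>2)"
    using integrable_std_normal_distribution_moment[of 1]
      integrable_std_normal_distribution_moment[of 2] by auto
  have e1: "(LINT x|?S. x) = 0"
    using integral_std_normal_distribution_moment_odd[of 1] by simp
  have e2: "(LINT x|?S. x\<^sup>2) = 1"
    using std_normal_distribution_even_moments(1)[of 1] by (simp add: eval_nat_numeral)
  have EX: "(LINT \<omega>|bvn_law \<rho>. h (fst \<omega>)) = (LINT x|?S. h x)"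
    and EY: "(LINT \<omega>|bvn_law \<rho>. h (snd \<omega>)) = (LINT x|?S. h x)"
    if "h \<in> borel_measurable borel" for h :: "real \<Rightarrow> real"
    using integral_distr[OF m(1), of h] integral_distr[OF m(2), of h] that X Y by simp_all
  have iP: "integrable ?P (\<lambda>z. (fst z)\<^sup>2)" "integrable ?P (\<lambda>z. fst z * snd z)"
  proof -
    show "integrable ?P (\<lambda>z. (fst z)\<^sup>2)"
      using P.Fubini_integrable[of "\<lambda>z. (fst z)\<^sup>2"] i2 by (simp add: measurable_split_conv)
    have "(\<lambda>z. fst z * snd z) \<in> borel_measurable ?P"
      by measurable
    moreover have "integrable ?S (\<lambda>u. LINT v|?S. norm (fst (u, v) * snd (u, v)))"
    proof -
      have "(LINT v|?S. norm (fst (u, v) * snd (u, v))) = \<bar>u\<bar> * (LINT v|?S. \<bar>v\<bar>)" for u :: real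
        by (simp only: fst_conv snd_conv real_norm_def abs_mult integral_mult_right_zero)
      then show ?thesis
        by (simp only:) (intro integrable_mult_left integrable_abs i1)
    qed
    moreover have "AE u in ?S. integrable ?S (\<lambda>v. fst (u, v) * snd (u, v))"
      by (simp only: fst_conv snd_conv) (intro AE_I2 integrable_mult_right i1)
    ultimately show "integrable ?P (\<lambda>z. fst z * snd z)"
      by (rule P.Fubini_integrable)
  qed
  have "(LINT \<omega>|bvn_law \<rho>. fst \<omega> * snd \<omega>) = (LINT z|?P. \<rho> * (fst z)\<^sup>2 + c * (fst z * snd z))"
    unfolding law by (subst integral_distr[OF gm])
      (auto simp: borel_prod [symmetric] g_def case_prod_beta power2_eq_square algebra_simps)
  also have "\<dots> = \<rho> * (LINT z|?P. (fst z)\<^sup>2) + c * (LINT z|?P. fst z * snd z)"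
    using iP by simp
  also have "(LINT z|?P. (fst z)\<^sup>2) = 1"
    using P.integral_fst'[OF iP(1)] e2 S.prob_space by simp
  also have "(LINT z|?P. fst z * snd z) = 0"
    using P.integral_fst'[OF iP(2)] e1 by simp
  finally have "correlation (bvn_law \<rho>) fst snd = \<rho>"
    using EX[of "\<lambda>x. x"] EY[of "\<lambda>x. x"] EX[of "\<lambda>x. x\<^sup>2"] EY[of "\<lambda>x. x\<^sup>2"] e1 e2
    by (simp add: correlation_def)
  with bn X Y show ?thesis
    by (simp add: std_bivariate_normal_def)
qed

end

theory Submission
  imports Defs
begin

text \<open>
  Let \<open>(X, Y)\<close> be standard bivariate normal with correlation \<open>\<rho>\<close>. The joint characteristic function
  is \<open>exp (- (t\<^sup>2 + 2 \<rho> t s + s\<^sup>2) / 2)\<close>, so \<open>pi\<^sup>2\<close> times the squared distance covariance is the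
  integral over the plane of \<open>exp (- t\<^sup>2 - s\<^sup>2) (exp (- \<rho> t s) - 1)\<^sup>2 / (t\<^sup>2 s\<^sup>2)\<close>. The singular
  denominator disappears after two differentiations with respect to \<open>\<rho>\<close>: what remains is a pair of
  Gaussian integrals, equal to \<open>4 pi\<close> times \<open>1 / sqrt (1 - \<rho>\<^sup>2) - 1 / sqrt (4 - \<rho>\<^sup>2)\<close>. Integrating
  this twice from \<open>0\<close>, where the function and its derivative vanish, gives
  \<open>4 pi\<close> times
  \<open>G \<rho> = \<rho> arcsin \<rho> + sqrt (1 - \<rho>\<^sup>2) - \<rho> arcsin (\<rho> / 2) - sqrt (4 - \<rho>\<^sup>2) + 1\<close>,
  called \<open>dcov_profile\<close> here.

  No differentiation under the integral sign takes place. The even part of the integrand is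
  written as an integral of its second derivative in \<open>\<rho>\<close> by Taylor's formula
  (\<open>cosh_kernel_taylor\<close>), Tonelli's theorem exchanges the integrals, and the same
  formula for \<open>G\<close> (\<open>dcov_profile_taylor\<close>) identifies the result
  (\<open>nn_integral_gaussian_covariance\<close>). Passing to the even part makes all integrands nonnegative.

  Since \<open>dcov_sq M X X\<close> and \<open>dcov_sq M Y Y\<close> are the case \<open>\<rho> = 1\<close>, the squared distance correlation
  is \<open>G \<rho> / G 1\<close>. The remaining claims concern \<open>G \<rho> / \<rho>\<^sup>2\<close> only. The second derivative of \<open>G\<close>
  is even, and increasing on \<open>[0, 1)\<close> from its value \<open>1 / 2\<close>; hence \<open>G \<rho> / \<rho>\<^sup>2\<close> is at least \<open>1 / 4\<close>
  (\<open>dcov_profile_ge\<close>), tends to \<open>1 / 4\<close> at \<open>0\<close> (\<open>dcov_profile_over_square_tendsto\<close>), and is at most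
  its value \<open>G 1\<close> at \<open>1\<close> (\<open>dcov_profile_le\<close>).
\<close>

section \<open>The profile function and its quadratic bounds\<close>

text \<open>
  For a standard bivariate normal pair with correlation \<open>r\<close>, the squared distance covariance turns
  out to be \<open>4 / pi\<close> times this function; see \<open>dcov_sq_gaussian\<close>.
\<close>
definition dcov_profile :: "real \<Rightarrow> real" where
  "dcov_profile r = r * arcsin r + sqrt (1 - r\<^sup>2) - r * arcsin (r / 2) - sqrt (4 - r\<^sup>2) + 1"

text \<open>
  This function and the next are the first and second derivatives of \<open>dcov_profile\<close> on \<open>(-1, 1)\<close>.
  At \<open>\<plusminus>1\<close> the second one takes a value without meaning, because there \<open>1 / sqrt (1 - r\<^sup>2)\<close> is a
  division by zero.
\<close>
definition dcov_profile' :: "real \<Rightarrow> real" where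
  "dcov_profile' r = arcsin r - arcsin (r / 2)"

definition dcov_profile'' :: "real \<Rightarrow> real" where
  "dcov_profile'' r = 1 / sqrt (1 - r\<^sup>2) - 1 / sqrt (4 - r\<^sup>2)"

lemma dcov_profile_0 [simp]: "dcov_profile 0 = 0"
  by (simp add: dcov_profile_def)

lemma dcov_profile'_0 [simp]: "dcov_profile' 0 = 0"
  by (simp add: dcov_profile'_def)

lemma dcov_profile''_0 [simp]: "dcov_profile'' 0 = 1 / 2"
  by (simp add: dcov_profile''_def)

lemma arcsin_half: "arcsin (1 / 2) = pi / 6"
  by (rule arcsin_unique) (auto simp: sin_30)

lemma dcov_profile_1: "dcov_profile 1 = 1 + pi / 3 - sqrt 3"
  by (simp add: dcov_profile_def arcsin_half)

lemma dcov_profile_minus: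
  assumes "\<bar>r\<bar> \<le> 1"
  shows "dcov_profile (- r) = dcov_profile r"
  using assms by (simp add: dcov_profile_def arcsin_minus abs_le_iff)

lemma dcov_profile_abs: "\<bar>r\<bar> \<le> 1 \<Longrightarrow> dcov_profile \<bar>r\<bar> = dcov_profile r"
  by (cases "r \<ge> 0") (simp_all add: dcov_profile_minus)

lemma DERIV_dcov_profile':
  assumes "\<bar>r\<bar> < 1"
  shows "(dcov_profile' has_real_derivative dcov_profile'' r) (at r)"
proof -
  have "sqrt (1 - (r / 2)\<^sup>2) = sqrt ((4 - r\<^sup>2) / 4)"
    by (simp add: power_divide diff_divide_distrib)
  then have "sqrt (1 - (r / 2)\<^sup>2) = sqrt (4 - r\<^sup>2) / 2"
    by (simp add: real_sqrt_divide)
  moreover have "((\<lambda>r. arcsin (r / 2)) has_real_derivative inverse (sqrt (1 - (r / 2)\<^sup>2)) * (1 / 2)) (at r)"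
    by (rule DERIV_chain2[where f = arcsin, OF DERIV_arcsin])
       (use assms in \<open>auto intro!: derivative_eq_intros\<close>)
  ultimately show ?thesis
    using DERIV_diff[OF DERIV_arcsin[of r]] assms
    unfolding dcov_profile'_def [abs_def] dcov_profile''_def
    by (fastforce simp: inverse_eq_divide)
qed

lemma DERIV_dcov_profile:
  assumes "\<bar>r\<bar> < 1"
  shows "(dcov_profile has_real_derivative dcov_profile' r) (at r)"
proof -
  have r2: "r\<^sup>2 < 1"
    using assms by (simp add: abs_square_less_1)
  have split: "dcov_profile = (\<lambda>r. r * dcov_profile' r + sqrt (1 - r\<^sup>2) - sqrt (4 - r\<^sup>2) + 1)"
    by (simp add: dcov_profile_def dcov_profile'_def fun_eq_iff algebra_simps)
  show ?thesis
    unfolding split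
    using assms r2 DERIV_dcov_profile'[OF assms]
    by (auto intro!: derivative_eq_intros simp: dcov_profile''_def field_simps)
qed

lemma continuous_on_dcov_profile: "continuous_on {-1..1} dcov_profile"
  unfolding dcov_profile_def [abs_def] by (intro continuous_intros) auto

lemma continuous_on_dcov_profile': "continuous_on {-1..1} dcov_profile'"
  unfolding dcov_profile'_def [abs_def] by (intro continuous_intros) auto

lemma borel_measurable_dcov_profile'' [measurable]: "dcov_profile'' \<in> borel_measurable borel"
  unfolding dcov_profile''_def [abs_def] by measurable

text \<open>
  With \<open>a = sqrt (1 - r\<^sup>2)\<close> and \<open>b = sqrt (4 - r\<^sup>2)\<close> one has \<open>b\<^sup>2 - a\<^sup>2 = 3\<close>, hence
  \<open>1 / a - 1 / b = 3 / (a b (a + b))\<close>. In this form monotonicity is visible without a third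
  derivative, since \<open>a\<close> and \<open>b\<close> decrease in \<open>\<bar>r\<bar>\<close>.
\<close>
lemma dcov_profile''_mono:
  assumes "0 \<le> x" "x \<le> y" "y < 1"
  shows "dcov_profile'' x \<le> dcov_profile'' y"
proof -
  have eq: "dcov_profile'' r = 3 / (sqrt (1 - r\<^sup>2) * sqrt (4 - r\<^sup>2) * (sqrt (1 - r\<^sup>2) + sqrt (4 - r\<^sup>2)))"
    if "r\<^sup>2 < 1" for r
  proof -
    define a b where "a = sqrt (1 - r\<^sup>2)" and "b = sqrt (4 - r\<^sup>2)"
    have "a > 0" "b > 0" and "(b - a) * (a + b) = 3"
      using that by (auto simp: a_def b_def algebra_simps simp flip: power2_eq_square)
    then show ?thesis
      unfolding dcov_profile''_def a_def [symmetric] b_def [symmetric]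
      by (simp add: divide_simps)
  qed
  have y2: "y\<^sup>2 < 1"
    using assms by (simp add: abs_square_less_1)
  have xy: "x\<^sup>2 \<le> y\<^sup>2"
    using assms by (simp add: power_mono)
  then have x2: "x\<^sup>2 < 1"
    using y2 by simp
  show ?thesis
    unfolding eq[OF x2] eq[OF y2]
    by (intro divide_left_mono mult_mono add_mono mult_pos_pos add_pos_pos mult_nonneg_nonneg)
       (use xy x2 y2 in auto)
qed

lemma dcov_profile''_ge: "0 \<le> r \<Longrightarrow> r < 1 \<Longrightarrow> 1 / 2 \<le> dcov_profile'' r"
  using dcov_profile''_mono[of 0 r] by simp

text \<open>
  The first derivative vanishes at \<open>0\<close> and the second one increases from \<open>1 / 2\<close>, so the mean value
  \<open>dcov_profile' r / r\<close> of the second derivative lies between its two end values.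
\<close>
lemma dcov_profile'_bounds:
  assumes "0 \<le> r" "r < 1"
  shows "r / 2 \<le> dcov_profile' r" and "dcov_profile' r \<le> r * dcov_profile'' r"
proof -
  have "r / 2 \<le> dcov_profile' r \<and> dcov_profile' r \<le> r * dcov_profile'' r"
  proof (cases "r = 0")
    case False
    then obtain z where z: "0 < z" "z < r" "dcov_profile' r - dcov_profile' 0 = (r - 0) * dcov_profile'' z"
      using MVT2[of 0 r dcov_profile' dcov_profile''] assms DERIV_dcov_profile' by force
    have "r * (1 / 2) \<le> r * dcov_profile'' z" "r * dcov_profile'' z \<le> r * dcov_profile'' r"
      by (rule mult_left_mono; use z assms dcov_profile''_ge[of z] dcov_profile''_mono[of z r] in simp)+
    then show ?thesis
      using z by simp
  qed simp
  then show "r / 2 \<le> dcov_profile' r" "dcov_profile' r \<le> r * dcov_profile'' r" by auto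
qed

text \<open>
  The quadratic \<open>r\<^sup>2 / 4\<close> is the Taylor polynomial at \<open>0\<close>. This bound gives the constant in the
  infimum and the positivity of the profile.
\<close>
lemma dcov_profile_ge:
  assumes "\<bar>r\<bar> \<le> 1"
  shows "r\<^sup>2 / 4 \<le> dcov_profile r"
proof -
  have "dcov_profile 0 - 0\<^sup>2 / 4 \<le> dcov_profile \<bar>r\<bar> - \<bar>r\<bar>\<^sup>2 / 4"
  proof (rule DERIV_nonneg_imp_increasing_open[where f = "\<lambda>r. dcov_profile r - r\<^sup>2 / 4"])
    show "\<exists>y. ((\<lambda>r. dcov_profile r - r\<^sup>2 / 4) has_real_derivative y) (at x) \<and> 0 \<le> y"
      if "0 < x" "x < \<bar>r\<bar>" for x
      using that assms dcov_profile'_bounds(1)[of x]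
      by (intro exI[of _ "dcov_profile' x - x / 2"])
         (auto intro!: derivative_eq_intros DERIV_dcov_profile)
    show "continuous_on {0..\<bar>r\<bar>} (\<lambda>r. dcov_profile r - r\<^sup>2 / 4)"
      by (intro continuous_intros continuous_on_subset[OF continuous_on_dcov_profile])
         (use assms in auto)
  qed auto
  then show ?thesis
    using assms by (simp add: dcov_profile_abs)
qed

lemma dcov_profile_nonneg: "\<bar>r\<bar> \<le> 1 \<Longrightarrow> 0 \<le> dcov_profile r"
  using dcov_profile_ge[of r] zero_le_power2[of r] by linarith

text \<open>
  The numerator of the derivative of \<open>dcov_profile r / r\<^sup>2\<close> is \<open>r * dcov_profile' r - 2 * dcov_profile r\<close>.
  It vanishes at \<open>0\<close> and has the derivative \<open>r * dcov_profile'' r - dcov_profile' r\<close>, which is nonnegative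
  by the preceding bounds.
\<close>
lemma twice_dcov_profile_le:
  assumes "0 \<le> r" "r < 1"
  shows "2 * dcov_profile r \<le> r * dcov_profile' r"
proof -
  have "0 * dcov_profile' 0 - 2 * dcov_profile 0 \<le> r * dcov_profile' r - 2 * dcov_profile r"
  proof (rule DERIV_nonneg_imp_nondecreasing[where f = "\<lambda>r. r * dcov_profile' r - 2 * dcov_profile r"])
    show "\<exists>y. ((\<lambda>r. r * dcov_profile' r - 2 * dcov_profile r) has_real_derivative y) (at x) \<and> 0 \<le> y"
      if "0 \<le> x" "x \<le> r" for x
      using that assms dcov_profile'_bounds(2)[of x]
      by (intro exI[of _ "x * dcov_profile'' x - dcov_profile' x"])
         (auto intro!: derivative_eq_intros DERIV_dcov_profile DERIV_dcov_profile')
  qed (use assms in auto)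
  then show ?thesis by simp
qed

text \<open>
  The upper half of a squeeze: the right-hand side divided by \<open>r\<^sup>2\<close> is continuous at \<open>0\<close>, with
  value \<open>1 / 4\<close>.
\<close>
lemma dcov_profile_le_second_order:
  assumes "\<bar>r\<bar> < 1"
  shows "dcov_profile r \<le> r\<^sup>2 * dcov_profile'' r / 2"
proof -
  have "2 * dcov_profile \<bar>r\<bar> \<le> \<bar>r\<bar> * dcov_profile' \<bar>r\<bar>"
    by (rule twice_dcov_profile_le) (use assms in auto)
  also have "\<dots> \<le> \<bar>r\<bar> * (\<bar>r\<bar> * dcov_profile'' \<bar>r\<bar>)"
    by (intro mult_left_mono dcov_profile'_bounds) (use assms in auto)
  also have "\<dots> = r\<^sup>2 * dcov_profile'' r"
    by (simp add: dcov_profile''_def power2_eq_square)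
  finally show ?thesis
    using assms by (simp add: dcov_profile_abs)
qed

text \<open>
  The quotient \<open>dcov_profile r / r\<^sup>2\<close> increases on \<open>(0, 1]\<close>, so it is largest at \<open>1\<close>. This is the
  inequality between distance correlation and correlation.
\<close>
lemma dcov_profile_le:
  assumes "\<bar>r\<bar> \<le> 1"
  shows "dcov_profile r \<le> r\<^sup>2 * dcov_profile 1"
proof (cases "r = 0")
  case False
  have "dcov_profile \<bar>r\<bar> / \<bar>r\<bar>\<^sup>2 \<le> dcov_profile 1 / 1\<^sup>2"
  proof (rule DERIV_nonneg_imp_increasing_open[where f = "\<lambda>r. dcov_profile r / r\<^sup>2"])
    show "\<exists>y. ((\<lambda>r. dcov_profile r / r\<^sup>2) has_real_derivative y) (at x) \<and> 0 \<le> y"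
      if "\<bar>r\<bar> < x" "x < 1" for x
    proof (intro exI conjI)
      have "x > 0" using that by auto
      then show "((\<lambda>r. dcov_profile r / r\<^sup>2) has_real_derivative
          (x * dcov_profile' x - 2 * dcov_profile x) / x ^ 3) (at x)"
        using that
        by (auto intro!: derivative_eq_intros DERIV_dcov_profile simp: field_simps eval_nat_numeral)
      show "0 \<le> (x * dcov_profile' x - 2 * dcov_profile x) / x ^ 3"
        using \<open>x > 0\<close> that twice_dcov_profile_le[of x] by auto
    qed
    show "continuous_on {\<bar>r\<bar>..1} (\<lambda>r. dcov_profile r / r\<^sup>2)"
      by (intro continuous_intros continuous_on_subset[OF continuous_on_dcov_profile])
         (use assms False in auto)
  qed (use assms in auto)
  then show ?thesis
    using assms False by (simp add: dcov_profile_abs field_simps)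
qed simp

lemma dcov_profile_1_pos: "dcov_profile 1 > 0"
  using dcov_profile_ge[of 1] by simp

lemma dcov_profile_over_square_tendsto:
  "((\<lambda>r. dcov_profile r / r\<^sup>2) \<longlongrightarrow> 1 / 4) (at 0)"
proof (rule tendsto_sandwich)
  have near: "\<forall>\<^sub>F r in at 0. r \<noteq> 0 \<and> \<bar>r :: real\<bar> < 1"
    by (auto simp: eventually_at intro: exI[of _ 1])
  show "\<forall>\<^sub>F r in at 0. 1 / 4 \<le> dcov_profile r / r\<^sup>2"
    using near by eventually_elim (use dcov_profile_ge in \<open>auto simp: field_simps\<close>)
  show "\<forall>\<^sub>F r in at 0. dcov_profile r / r\<^sup>2 \<le> dcov_profile'' r / 2"
    using near by eventually_elim (use dcov_profile_le_second_order in \<open>auto simp: field_simps\<close>)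
  have "((\<lambda>r. dcov_profile'' r / 2) \<longlongrightarrow> (1 / sqrt (1 - 0\<^sup>2) - 1 / sqrt (4 - 0\<^sup>2)) / 2) (at 0)"
    unfolding dcov_profile''_def by (intro tendsto_intros) auto
  then show "((\<lambda>r. dcov_profile'' r / 2) \<longlongrightarrow> 1 / 4) (at 0)"
    by simp
qed simp

lemma limit_constant_approx: "\<bar>1 / (2 * sqrt (1 + pi / 3 - sqrt 3)) - 0.89066\<bar> < (0.000005 :: real)"
proof -
  \<comment> \<open>The value is about 0.8906634, so the margin to the bound is about 1.6e-6. An error in \<open>pi / 3 - sqrt 3\<close>
    is amplified by a factor of about 1.4.\<close>
  have "1.7320508 < sqrt (3 :: real)"
    by (rule real_less_rsqrt) (simp add: power2_eq_square)
  moreover have "sqrt (3 :: real) < 1.7320509"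
    by (rule real_less_lsqrt) (simp_all add: power2_eq_square)
  ultimately have s: "1.7320508 < sqrt (3 :: real)" "sqrt (3 :: real) < 1.7320509" by auto
  let ?c = "1 + pi / 3 - sqrt 3"
  have "pi > 3.14159265" "pi < 3.14159266"
    using pi_approx by auto
  with s have c: "0.3151466 < ?c" "?c < 0.3151469"
    by auto
  have r: "0.561379 < sqrt ?c" "sqrt ?c < 0.56138"
    by (rule real_less_rsqrt real_less_lsqrt; use c in \<open>simp add: power2_eq_square\<close>)+
  define q where "q = sqrt ?c"
  have "1 / (2 * q) < 0.890665" "0.890655 < 1 / (2 * q)"
    using r unfolding q_def [symmetric] by (simp_all add: field_simps)
  moreover define z where "z = 1 / (2 * q)"
  ultimately show ?thesis
    unfolding q_def [symmetric] z_def [symmetric] by (simp add: abs_if)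
qed

section \<open>The weighted Gaussian integral\<close>

text \<open>
  Completing the square turns the integrand into a multiple of the normal density with mean
  \<open>b / (2 a)\<close> and variance \<open>1 / (2 a)\<close>.
\<close>
lemma has_bochner_integral_gaussian:
  fixes a b :: real
  assumes "a > 0"
  shows "has_bochner_integral lborel (\<lambda>x. exp (b * x - a * x\<^sup>2)) (sqrt (pi / a) * exp (b\<^sup>2 / (4 * a)))"
proof -
  define \<mu> \<sigma> where "\<mu> = b / (2 * a)" and "\<sigma> = 1 / sqrt (2 * a)"
  have \<sigma>: "\<sigma> > 0" "\<sigma>\<^sup>2 = 1 / (2 * a)"
    using assms by (auto simp: \<sigma>_def power_divide)
  have "has_bochner_integral lborel (\<lambda>x. sqrt (pi / a) * exp (b\<^sup>2 / (4 * a)) * normal_density \<mu> \<sigma> x)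
      (sqrt (pi / a) * exp (b\<^sup>2 / (4 * a)) * 1)"
    using \<sigma> by (intro has_bochner_integral_mult_right) (simp add: has_bochner_integral_iff)
  moreover have "sqrt (pi / a) * exp (b\<^sup>2 / (4 * a)) * normal_density \<mu> \<sigma> x = exp (b * x - a * x\<^sup>2)" for x
  proof -
    have "b\<^sup>2 / (4 * a) + - ((x - \<mu>)\<^sup>2 / (2 * \<sigma>\<^sup>2)) = b * x - a * x\<^sup>2"
      using assms unfolding \<sigma> \<mu>_def by (simp add: power2_eq_square field_simps)
    moreover have "sqrt (pi / a) * (1 / sqrt (2 * pi * \<sigma>\<^sup>2)) = 1"
      using assms unfolding \<sigma> by (simp add: real_sqrt_divide)
    ultimately show ?thesis
      using assms unfolding normal_density_def by (simp add: mult_ac flip: exp_add)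
  qed
  ultimately show ?thesis by simp
qed

lemma has_bochner_integral_gaussian_cosh:
  "has_bochner_integral lborel (\<lambda>s. exp (- s\<^sup>2) * cosh (c * s)) (sqrt pi * exp (c\<^sup>2 / 4))"
proof -
  have "has_bochner_integral lborel (\<lambda>s. (exp (c * s - 1 * s\<^sup>2) + exp (- c * s - 1 * s\<^sup>2)) / 2)
      ((sqrt (pi / 1) * exp (c\<^sup>2 / (4 * 1)) + sqrt (pi / 1) * exp ((- c)\<^sup>2 / (4 * 1))) / 2)"
    by (intro has_bochner_integral_divide has_bochner_integral_add has_bochner_integral_gaussian) auto
  then show ?thesis
    by (simp add: cosh_def exp_diff exp_minus field_simps)
qed

text \<open>
  The second derivative of \<open>\<lambda>x. cosh (2 * x) - 2 * cosh x + 1\<close>, the even part of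
  \<open>\<lambda>x. (exp (- x) - 1)\<^sup>2\<close>.
\<close>
definition cosh_kernel :: "real \<Rightarrow> real" where
  "cosh_kernel x = 4 * cosh (2 * x) - 2 * cosh x"

text \<open>
  Nonnegativity is what allows the order of integration to be exchanged below without any
  integrability argument.
\<close>
lemma cosh_kernel_nonneg: "0 \<le> cosh_kernel x"
proof -
  have "cosh (2 * x) = 2 * (cosh x)\<^sup>2 - 1"
    by (simp add: cosh_double sinh_square_eq)
  moreover have "cosh x \<le> (cosh x)\<^sup>2"
    using cosh_real_ge_1[of x] by (simp add: power2_eq_square)
  ultimately show ?thesis
    using cosh_real_ge_1[of x] unfolding cosh_kernel_def by linarith
qed

lemma cosh_kernel_measurable [measurable]: "cosh_kernel \<in> borel_measurable borel"
  unfolding cosh_kernel_def cosh_def by measurable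

text \<open>
  Each of the two \<open>cosh\<close> terms gives a two-dimensional Gaussian integral. Integrating over \<open>s\<close>
  leaves \<open>exp (- (1 - r\<^sup>2) * t\<^sup>2)\<close> and \<open>exp (- (1 - r\<^sup>2 / 4) * t\<^sup>2)\<close>, whose integrals over \<open>t\<close> produce the two
  inverse square roots of \<open>dcov_profile''\<close>. At \<open>r = 1\<close> the integral diverges.
\<close>
lemma nn_integral_gaussian_cosh_kernel:
  assumes "0 \<le> r" "r < 1"
  shows "(\<integral>\<^sup>+t. \<integral>\<^sup>+s. ennreal (exp (- (t\<^sup>2 + s\<^sup>2)) * cosh_kernel (r * (t * s))) \<partial>lborel \<partial>lborel)
    = ennreal (4 * pi * dcov_profile'' r)"
proof -
  have r2: "r\<^sup>2 < 1"
    using assms by (simp add: abs_square_less_1)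
  have nonneg: "0 \<le> exp (- (t\<^sup>2 + s\<^sup>2)) * cosh_kernel (r * (t * s))" for t s
    by (simp add: cosh_kernel_nonneg)
  have inner: "has_bochner_integral lborel (\<lambda>s. exp (- (t\<^sup>2 + s\<^sup>2)) * cosh_kernel (r * (t * s)))
      (4 * sqrt pi * exp (0 * t - (1 - r\<^sup>2) * t\<^sup>2) - 2 * sqrt pi * exp (0 * t - (1 - r\<^sup>2 / 4) * t\<^sup>2))" for t
  proof -
    have "has_bochner_integral lborel
        (\<lambda>s. exp (- t\<^sup>2) * (4 * (exp (- s\<^sup>2) * cosh ((2 * r * t) * s)) - 2 * (exp (- s\<^sup>2) * cosh ((r * t) * s))))
        (exp (- t\<^sup>2) * (4 * (sqrt pi * exp ((2 * r * t)\<^sup>2 / 4)) - 2 * (sqrt pi * exp ((r * t)\<^sup>2 / 4))))"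
      by (intro has_bochner_integral_mult_right has_bochner_integral_diff has_bochner_integral_gaussian_cosh)
    moreover have "exp (- t\<^sup>2) * (4 * (sqrt pi * exp ((2 * r * t)\<^sup>2 / 4)) - 2 * (sqrt pi * exp ((r * t)\<^sup>2 / 4)))
        = 4 * sqrt pi * exp (0 * t - (1 - r\<^sup>2) * t\<^sup>2) - 2 * sqrt pi * exp (0 * t - (1 - r\<^sup>2 / 4) * t\<^sup>2)"
      by (simp add: power_mult_distrib algebra_simps flip: exp_add)
    moreover have "exp (- t\<^sup>2) * (4 * (exp (- s\<^sup>2) * cosh ((2 * r * t) * s)) - 2 * (exp (- s\<^sup>2) * cosh ((r * t) * s)))
        = exp (- (t\<^sup>2 + s\<^sup>2)) * cosh_kernel (r * (t * s))" for s
      unfolding minus_add_distrib exp_add by (simp add: cosh_kernel_def algebra_simps)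
    ultimately show ?thesis by simp
  qed
  have outer: "has_bochner_integral lborel
      (\<lambda>t. 4 * sqrt pi * exp (0 * t - (1 - r\<^sup>2) * t\<^sup>2) - 2 * sqrt pi * exp (0 * t - (1 - r\<^sup>2 / 4) * t\<^sup>2))
      (4 * sqrt pi * (sqrt (pi / (1 - r\<^sup>2)) * exp (0\<^sup>2 / (4 * (1 - r\<^sup>2))))
        - 2 * sqrt pi * (sqrt (pi / (1 - r\<^sup>2 / 4)) * exp (0\<^sup>2 / (4 * (1 - r\<^sup>2 / 4)))))"
    by (intro has_bochner_integral_mult_right has_bochner_integral_diff has_bochner_integral_gaussian)
       (use r2 in auto)
  have total: "4 * sqrt pi * (sqrt (pi / (1 - r\<^sup>2)) * exp (0\<^sup>2 / (4 * (1 - r\<^sup>2))))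
        - 2 * sqrt pi * (sqrt (pi / (1 - r\<^sup>2 / 4)) * exp (0\<^sup>2 / (4 * (1 - r\<^sup>2 / 4))))
      = 4 * pi * dcov_profile'' r"
  proof -
    have "sqrt (1 - r\<^sup>2 / 4) = sqrt ((4 - r\<^sup>2) / 4)"
      by (simp add: diff_divide_distrib)
    then have half: "sqrt (1 - r\<^sup>2 / 4) = sqrt (4 - r\<^sup>2) / 2"
      by (simp add: real_sqrt_divide)
    have pi: "sqrt pi * (sqrt pi * x) = pi * x" for x
      by (simp flip: mult.assoc)
    show ?thesis
      unfolding dcov_profile''_def real_sqrt_divide half by (simp add: algebra_simps pi)
  qed
  have "(\<integral>\<^sup>+t. \<integral>\<^sup>+s. ennreal (exp (- (t\<^sup>2 + s\<^sup>2)) * cosh_kernel (r * (t * s))) \<partial>lborel \<partial>lborel)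
    = (\<integral>\<^sup>+t. ennreal (4 * sqrt pi * exp (0 * t - (1 - r\<^sup>2) * t\<^sup>2)
        - 2 * sqrt pi * exp (0 * t - (1 - r\<^sup>2 / 4) * t\<^sup>2)) \<partial>lborel)"
    using inner nonneg
    by (intro nn_integral_cong) (simp add: has_bochner_integral_iff nn_integral_eq_integral)
  also have "\<dots> = ennreal (4 * pi * dcov_profile'' r)"
  proof -
    have pos: "0 \<le> 4 * sqrt pi * exp (0 * t - (1 - r\<^sup>2) * t\<^sup>2) - 2 * sqrt pi * exp (0 * t - (1 - r\<^sup>2 / 4) * t\<^sup>2)" for t
      unfolding has_bochner_integral_integral_eq[OF inner, symmetric]
      by (rule Bochner_Integration.integral_nonneg) (rule nonneg)
    show ?thesis
      using outer pos unfolding total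
      by (subst nn_integral_eq_integral) (auto simp: has_bochner_integral_iff)
  qed
  finally show ?thesis .
qed

text \<open>
  A fundamental theorem of calculus that asks for the derivative only inside the interval, as
  needed for \<open>arcsin\<close> up to the end point \<open>1\<close>.
\<close>
lemma nn_integral_interval:
  fixes f F :: "real \<Rightarrow> real"
  assumes "a \<le> b" and F: "continuous_on {a..b} F"
    and deriv: "\<And>x. a < x \<Longrightarrow> x < b \<Longrightarrow> (F has_real_derivative f x) (at x)"
    and [measurable]: "f \<in> borel_measurable borel"
    and nonneg: "\<And>x. a \<le> x \<Longrightarrow> x \<le> b \<Longrightarrow> 0 \<le> f x"
  shows "(\<integral>\<^sup>+x. ennreal (indicator {a..b} x * f x) \<partial>lborel) = ennreal (F b - F a)"
proof (rule nn_integral_has_integral_lborel)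
  have "(f has_integral F b - F a) {a..b}"
    using assms(1) F deriv
    by (intro fundamental_theorem_of_calculus_interior)
       (auto simp: has_real_derivative_iff_has_vector_derivative)
  then have "((\<lambda>x. if x \<in> {a..b} then f x else 0) has_integral F b - F a) UNIV"
    by (simp only: has_integral_restrict_UNIV)
  then show "((\<lambda>x. indicator {a..b} x * f x) has_integral F b - F a) UNIV"
    by (rule has_integral_eq[rotated]) (auto simp: indicator_def)
qed (use nonneg in \<open>auto simp: indicator_def\<close>)

text \<open>
  Taylor's formula with integral remainder for \<open>\<lambda>r. (cosh (2 * r * p) - 2 * cosh (r * p) + 1) / p\<^sup>2\<close>,
  which vanishes to first order at \<open>0\<close> and has the second derivative \<open>cosh_kernel (r * p)\<close>.
\<close>
lemma cosh_kernel_taylor: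
  assumes "0 \<le> \<rho>" "p \<noteq> 0"
  shows "(\<integral>\<^sup>+r. ennreal (indicator {0..\<rho>} r * ((\<rho> - r) * cosh_kernel (r * p))) \<partial>lborel)
    = ennreal ((cosh (2 * \<rho> * p) - 2 * cosh (\<rho> * p) + 1) / p\<^sup>2)"
proof -
  \<comment> \<open>Integration by parts suggests this antiderivative.\<close>
  define F where "F r = (\<rho> - r) * (2 * sinh (2 * r * p) - 2 * sinh (r * p)) / p
      + (cosh (2 * r * p) - 2 * cosh (r * p)) / p\<^sup>2" for r
  have "(F has_real_derivative (\<rho> - r) * cosh_kernel (r * p)) (at r)" for r
    unfolding F_def cosh_kernel_def using assms(2)
    by (auto intro!: derivative_eq_intros simp: field_simps power2_eq_square)
  moreover from this have "continuous_on {0..\<rho>} F"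
    by (meson DERIV_isCont continuous_at_imp_continuous_on)
  ultimately have "(\<integral>\<^sup>+r. ennreal (indicator {0..\<rho>} r * ((\<rho> - r) * cosh_kernel (r * p))) \<partial>lborel)
      = ennreal (F \<rho> - F 0)"
    using assms(1) by (intro nn_integral_interval) (auto simp: cosh_kernel_nonneg)
  also have "F \<rho> - F 0 = (cosh (2 * \<rho> * p) - 2 * cosh (\<rho> * p) + 1) / p\<^sup>2"
    by (simp add: F_def diff_divide_distrib add_divide_distrib)
  finally show ?thesis .
qed

text \<open>
  The same Taylor formula for \<open>dcov_profile\<close>. If \<open>\<rho> = 1\<close>, the factor \<open>\<rho> - r\<close> hides the meaningless
  negative value of \<open>dcov_profile''\<close> at \<open>r = 1\<close>.
\<close>
lemma dcov_profile_taylor: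
  assumes "0 \<le> \<rho>" "\<rho> \<le> 1"
  shows "(\<integral>\<^sup>+r. ennreal (indicator {0..\<rho>} r * ((\<rho> - r) * dcov_profile'' r)) \<partial>lborel)
    = ennreal (dcov_profile \<rho>)"
proof -
  define F where "F r = (\<rho> - r) * dcov_profile' r + dcov_profile r" for r
  have "continuous_on {0..\<rho>} F"
    unfolding F_def [abs_def]
    by (intro continuous_intros continuous_on_subset[OF continuous_on_dcov_profile]
        continuous_on_subset[OF continuous_on_dcov_profile']) (use assms in auto)
  moreover have "(F has_real_derivative (\<rho> - r) * dcov_profile'' r) (at r)" if "0 < r" "r < \<rho>" for r
    unfolding F_def [abs_def] using that assms
    by (auto intro!: derivative_eq_intros DERIV_dcov_profile DERIV_dcov_profile')
  moreover have "0 \<le> (\<rho> - r) * dcov_profile'' r" if "0 \<le> r" "r \<le> \<rho>" for r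
  proof (cases "r = \<rho>")
    case False
    then show ?thesis
      using that assms dcov_profile''_ge[of r] by simp
  qed simp
  ultimately have "(\<integral>\<^sup>+r. ennreal (indicator {0..\<rho>} r * ((\<rho> - r) * dcov_profile'' r)) \<partial>lborel)
      = ennreal (F \<rho> - F 0)"
    using assms(1) by (intro nn_integral_interval) auto
  then show ?thesis
    by (simp add: F_def)
qed

text \<open>
  Averaging over \<open>s\<close> and \<open>- s\<close> replaces \<open>(exp (- x) - 1)\<^sup>2\<close> by its even part, which Taylor's
  formula writes as an integral of the nonnegative \<open>cosh_kernel\<close> over the correlation parameter
  \<open>r\<close>. By Tonelli's theorem the integral over \<open>r\<close> may be done last. The inner Gaussian integrals then
  yield \<open>dcov_profile''\<close>, and a second use of Taylor's formula recovers \<open>dcov_profile\<close>.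
\<close>
lemma nn_integral_gaussian_covariance:
  assumes "\<bar>\<rho>\<bar> \<le> 1"
  shows "(\<integral>\<^sup>+t. \<integral>\<^sup>+s. ennreal (exp (- (t\<^sup>2 + s\<^sup>2)) * ((exp (- \<rho> * (t * s)) - 1)\<^sup>2 / (t\<^sup>2 * s\<^sup>2))) \<partial>lborel \<partial>lborel)
    = ennreal (4 * pi * dcov_profile \<rho>)"
proof -
  define w where "w t s = exp (- (t\<^sup>2 + s\<^sup>2))" for t s :: real
  define \<phi> where "\<phi> t s = w t s * ((exp (- \<rho> * (t * s)) - 1)\<^sup>2 / (t\<^sup>2 * s\<^sup>2))" for t s
  define f where "f t s r = indicator {0..\<bar>\<rho>\<bar>} r * ((\<bar>\<rho>\<bar> - r) * (w t s * cosh_kernel (r * (t * s))))" for t s r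
  have [measurable]: "case_prod w \<in> borel_measurable (borel \<Otimes>\<^sub>M borel)"
    unfolding w_def by measurable
  have w_nonneg: "0 \<le> w t s" for t s by (simp add: w_def)
  have \<phi>_nonneg: "0 \<le> \<phi> t s" for t s by (simp add: \<phi>_def w_nonneg)
  have [measurable]: "\<phi> t \<in> borel_measurable borel" for t
    unfolding \<phi>_def [abs_def] w_def by measurable
  have reflect: "(\<integral>\<^sup>+s. ennreal (\<phi> t s) \<partial>lborel) = (\<integral>\<^sup>+s. ennreal ((\<phi> t s + \<phi> t (- s)) / 2) \<partial>lborel)" for t
  proof -
    have "(\<integral>\<^sup>+s. ennreal (\<phi> t s) \<partial>lborel) = (\<integral>\<^sup>+s. ennreal (\<phi> t s / 2) + ennreal (\<phi> t s / 2) \<partial>lborel)"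
      using \<phi>_nonneg by (simp flip: ennreal_plus)
    also have "\<dots> = (\<integral>\<^sup>+s. ennreal (\<phi> t s / 2) \<partial>lborel) + (\<integral>\<^sup>+s. ennreal (\<phi> t s / 2) \<partial>lborel)"
      by (rule nn_integral_add) auto
    also have "\<dots> = (\<integral>\<^sup>+s. ennreal (\<phi> t s / 2) \<partial>lborel) + (\<integral>\<^sup>+s. ennreal (\<phi> t (- s) / 2) \<partial>lborel)"
      using nn_integral_real_affine[of "\<lambda>s. ennreal (\<phi> t s / 2)" "-1" 0] by simp
    also have "\<dots> = (\<integral>\<^sup>+s. ennreal (\<phi> t s / 2) + ennreal (\<phi> t (- s) / 2) \<partial>lborel)"
      by (rule nn_integral_add [symmetric]) auto
    finally show ?thesis
      using \<phi>_nonneg by (simp add: add_divide_distrib)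
  qed
  have sym: "(\<phi> t s + \<phi> t (- s)) / 2
      = w t s * ((cosh (2 * \<bar>\<rho>\<bar> * (t * s)) - 2 * cosh (\<bar>\<rho>\<bar> * (t * s)) + 1) / (t * s)\<^sup>2)" for t s
  proof -
    define x where "x = \<rho> * (t * s)"
    have c: "cosh (2 * \<bar>\<rho>\<bar> * (t * s)) = cosh (2 * x)" "cosh (\<bar>\<rho>\<bar> * (t * s)) = cosh x"
      by (cases "\<rho> \<ge> 0"; simp add: x_def mult.assoc)+
    have e: "exp (2 * x) = (exp x)\<^sup>2" "exp (- (2 * x)) = (exp (- x))\<^sup>2"
      by (simp_all add: power2_eq_square flip: exp_add)
    have h: "((exp (- x) - 1)\<^sup>2 + (exp x - 1)\<^sup>2) / 2 = cosh (2 * x) - 2 * cosh x + 1"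
      unfolding cosh_field_def e by (simp add: power2_eq_square field_simps)
    have "(\<phi> t s + \<phi> t (- s)) / 2
        = w t s * (((exp (- x) - 1)\<^sup>2 + (exp x - 1)\<^sup>2) / 2 / (t * s)\<^sup>2)"
      by (simp add: \<phi>_def w_def x_def power_mult_distrib distrib_left add_divide_distrib)
    then show ?thesis
      unfolding c h .
  qed
  have taylor: "ennreal ((\<phi> t s + \<phi> t (- s)) / 2) = (\<integral>\<^sup>+r. ennreal (f t s r) \<partial>lborel)"
    if "t \<noteq> 0" "s \<noteq> 0" for t s
  proof -
    have "ennreal ((\<phi> t s + \<phi> t (- s)) / 2) = ennreal (w t s)
        * (\<integral>\<^sup>+r. ennreal (indicator {0..\<bar>\<rho>\<bar>} r * ((\<bar>\<rho>\<bar> - r) * cosh_kernel (r * (t * s)))) \<partial>lborel)"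
      using that unfolding sym by (subst cosh_kernel_taylor) (auto simp: w_nonneg simp flip: ennreal_mult')
    also have "\<dots> = (\<integral>\<^sup>+r. ennreal (f t s r) \<partial>lborel)"
      by (subst nn_integral_cmult [symmetric])
         (auto simp: f_def w_nonneg mult_ac simp flip: ennreal_mult' intro!: nn_integral_cong)
    finally show ?thesis .
  qed
  have "(\<integral>\<^sup>+t. \<integral>\<^sup>+s. ennreal (\<phi> t s) \<partial>lborel \<partial>lborel)
      = (\<integral>\<^sup>+t. \<integral>\<^sup>+s. \<integral>\<^sup>+r. ennreal (f t s r) \<partial>lborel \<partial>lborel \<partial>lborel)"
  proof (rule nn_integral_cong_AE)
    show "AE t in lborel. (\<integral>\<^sup>+s. ennreal (\<phi> t s) \<partial>lborel)
        = (\<integral>\<^sup>+s. \<integral>\<^sup>+r. ennreal (f t s r) \<partial>lborel \<partial>lborel)"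
      using AE_lborel_singleton[of 0]
    proof eventually_elim
      case (elim t)
      have "AE s in lborel. ennreal ((\<phi> t s + \<phi> t (- s)) / 2) = (\<integral>\<^sup>+r. ennreal (f t s r) \<partial>lborel)"
        using AE_lborel_singleton[of 0] by eventually_elim (use elim taylor in auto)
      then show ?case
        unfolding reflect by (rule nn_integral_cong_AE)
    qed
  qed
  also have "\<dots> = (\<integral>\<^sup>+t. \<integral>\<^sup>+r. \<integral>\<^sup>+s. ennreal (f t s r) \<partial>lborel \<partial>lborel \<partial>lborel)"
    unfolding f_def w_def by (intro nn_integral_cong lborel_pair.Fubini') measurable
  also have "\<dots> = (\<integral>\<^sup>+r. \<integral>\<^sup>+t. \<integral>\<^sup>+s. ennreal (f t s r) \<partial>lborel \<partial>lborel \<partial>lborel)"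
    unfolding f_def w_def by (intro lborel_pair.Fubini') measurable
  also have "\<dots> = (\<integral>\<^sup>+r. ennreal (4 * pi) * ennreal (indicator {0..\<bar>\<rho>\<bar>} r * ((\<bar>\<rho>\<bar> - r) * dcov_profile'' r)) \<partial>lborel)"
  proof (rule nn_integral_cong)
    fix r :: real
    show "(\<integral>\<^sup>+t. \<integral>\<^sup>+s. ennreal (f t s r) \<partial>lborel \<partial>lborel)
        = ennreal (4 * pi) * ennreal (indicator {0..\<bar>\<rho>\<bar>} r * ((\<bar>\<rho>\<bar> - r) * dcov_profile'' r))"
    proof (cases "0 \<le> r \<and> r < \<bar>\<rho>\<bar>")
      case True
      have "ennreal (f t s r) = ennreal (\<bar>\<rho>\<bar> - r) * ennreal (w t s * cosh_kernel (r * (t * s)))" for t s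
        using True by (simp add: f_def ennreal_mult')
      then have "(\<integral>\<^sup>+t. \<integral>\<^sup>+s. ennreal (f t s r) \<partial>lborel \<partial>lborel) = ennreal (\<bar>\<rho>\<bar> - r)
          * (\<integral>\<^sup>+t. \<integral>\<^sup>+s. ennreal (w t s * cosh_kernel (r * (t * s))) \<partial>lborel \<partial>lborel)"
        by (simp add: nn_integral_cmult)
      also have "\<dots> = ennreal (\<bar>\<rho>\<bar> - r) * ennreal (4 * pi * dcov_profile'' r)"
        unfolding w_def using True assms by (subst nn_integral_gaussian_cosh_kernel) auto
      finally show ?thesis
        using True by (simp add: mult_ac flip: ennreal_mult')
    next
      case False
      \<comment> \<open>At \<open>r = \<bar>\<rho>\<bar>\<close> both sides vanish, although the Gaussian integral diverges there if \<open>\<bar>\<rho>\<bar> = 1\<close>.\<close>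
      then show ?thesis
        by (cases "r = \<bar>\<rho>\<bar>") (auto simp: f_def indicator_def)
    qed
  qed
  also have "\<dots> = ennreal (4 * pi) * ennreal (dcov_profile \<bar>\<rho>\<bar>)"
    using assms by (subst nn_integral_cmult) (auto simp: dcov_profile_taylor)
  also have "\<dots> = ennreal (4 * pi * dcov_profile \<rho>)"
    using assms by (simp add: dcov_profile_abs flip: ennreal_mult')
  finally show ?thesis
    unfolding \<phi>_def w_def .
qed

section \<open>Characteristic functions of standard bivariate normal pairs\<close>

lemma joint_char_self:
  assumes [measurable]: "X \<in> borel_measurable M"
  shows "joint_char M X X t s = char (distr M borel X) (t + s)"
  unfolding joint_char_def char_def
  by (subst integral_distr) (auto simp: algebra_simps)

text \<open>
  The case \<open>\<rho> = 1\<close> covers \<open>dcov_sq M X X\<close>, because \<open>joint_char M X X t s\<close> is the Gaussian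
  \<open>exp (- (t + s)\<^sup>2 / 2)\<close>.
\<close>
lemma dcov_sq_gaussian:
  assumes \<rho>: "\<bar>\<rho>\<bar> \<le> 1"
    and joint: "\<And>t s. joint_char M X Y t s = complex_of_real (exp (- (t\<^sup>2 + 2 * \<rho> * (t * s) + s\<^sup>2) / 2))"
    and X: "distr M borel X = std_normal_distribution"
    and Y: "distr M borel Y = std_normal_distribution"
  shows "dcov_sq M X Y = 4 / pi * dcov_profile \<rho>"
proof -
  define f where "f = (\<lambda>(t, s). exp (- (t\<^sup>2 + s\<^sup>2)) * ((exp (- \<rho> * (t * s)) - 1)\<^sup>2 / (t\<^sup>2 * s\<^sup>2)) :: real)"
  have [measurable]: "f \<in> borel_measurable (lborel \<Otimes>\<^sub>M lborel)"
    unfolding f_def by measurable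
  have integrand: "(cmod (joint_char M X Y t s - char (distr M borel X) t * char (distr M borel Y) s))\<^sup>2
      / (t\<^sup>2 * s\<^sup>2) = f (t, s)" for t s
  proof -
    define g where "g = exp (- (t\<^sup>2 + s\<^sup>2) / 2)"
    \<comment> \<open>The product of the marginal characteristic functions, \<open>g\<close>, factors out.\<close>
    have "joint_char M X Y t s - char (distr M borel X) t * char (distr M borel Y) s
        = complex_of_real (g * (exp (- \<rho> * (t * s)) - 1))"
      by (simp add: joint X Y char_std_normal_distribution g_def algebra_simps
        add_divide_distrib diff_divide_distrib flip: exp_add of_real_mult)
    moreover have "g\<^sup>2 = exp (- (t\<^sup>2 + s\<^sup>2))"
      by (simp add: g_def power2_eq_square flip: exp_add)
    ultimately show ?thesis
      by (simp add: f_def power_mult_distrib flip: of_real_mult)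
  qed
  have "(\<integral>\<^sup>+z. ennreal (f z) \<partial>lborel) = (\<integral>\<^sup>+t. \<integral>\<^sup>+s. ennreal (f (t, s)) \<partial>lborel \<partial>lborel)"
    unfolding lborel_prod [symmetric] by (rule lborel.nn_integral_fst [symmetric]) simp
  also have "\<dots> = ennreal (4 * pi * dcov_profile \<rho>)"
    unfolding f_def using nn_integral_gaussian_covariance[OF \<rho>] by simp
  finally have "(LINT z|lborel. f z) = 4 * pi * dcov_profile \<rho>"
    using dcov_profile_nonneg[OF \<rho>]
    by (subst integral_eq_nn_integral) (auto simp: f_def simp flip: lborel_prod)
  then show ?thesis
    unfolding dcov_sq_def integrand by (simp add: f_def power2_eq_square)
qed

lemma integrable_std_normal_low_moments:
  "integrable std_normal_distribution (\<lambda>x. x)"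
  "integrable std_normal_distribution (\<lambda>x. x\<^sup>2)"
  using integrable_std_normal_distribution_moment[of 1]
    integrable_std_normal_distribution_moment[of 2] by auto

lemma std_normal_low_moments:
  "(LINT x|std_normal_distribution. x) = 0"
  "(LINT x|std_normal_distribution. x\<^sup>2) = 1"
  using integral_std_normal_distribution_moment_odd[of 1]
    std_normal_distribution_even_moments(1)[of 1] by (simp_all add: eval_nat_numeral)

lemma normal_law_moments:
  assumes "0 \<le> \<sigma>"
  shows "(LINT x|normal_law \<mu> \<sigma>. x) = \<mu>" and "(LINT x|normal_law \<mu> \<sigma>. x\<^sup>2) = \<mu>\<^sup>2 + \<sigma>\<^sup>2"
proof -
  let ?S = std_normal_distribution
  interpret S: prob_space ?S
    using real_dist_normal_dist by (simp add: real_distribution_def)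
  note i = integrable_std_normal_low_moments and e = std_normal_low_moments
  have one: "measure ?S UNIV = 1"
    using S.prob_space by simp
  show "(LINT x|normal_law \<mu> \<sigma>. x) = \<mu>"
    unfolding normal_law_eq_distr[OF assms] by (subst integral_distr) (auto simp: i e one)
  have "(LINT x|normal_law \<mu> \<sigma>. x\<^sup>2) = (LINT x|?S. \<mu>\<^sup>2 + 2 * \<mu> * \<sigma> * x + \<sigma>\<^sup>2 * x\<^sup>2)"
    unfolding normal_law_eq_distr[OF assms]
    by (subst integral_distr) (auto simp: power2_eq_square algebra_simps)
  also have "\<dots> = \<mu>\<^sup>2 + \<sigma>\<^sup>2"
    by (simp add: i e one)
  finally show "(LINT x|normal_law \<mu> \<sigma>. x\<^sup>2) = \<mu>\<^sup>2 + \<sigma>\<^sup>2" .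
qed

text \<open>
  A linear combination is normal by definition, and a normal law is determined by its first two
  moments. These follow from the marginals and from \<open>E (X Y) = \<rho>\<close>.
\<close>
lemma std_bivariate_normal_combination:
  assumes "std_bivariate_normal M X Y \<rho>"
  shows "0 \<le> t\<^sup>2 + 2 * \<rho> * (t * s) + s\<^sup>2" (is "0 \<le> ?v")
    and "distr M borel (\<lambda>\<omega>. t * X \<omega> + s * Y \<omega>) = normal_law 0 (sqrt (t\<^sup>2 + 2 * \<rho> * (t * s) + s\<^sup>2))"
proof -
  let ?S = std_normal_distribution
  have "prob_space M" and [measurable]: "X \<in> borel_measurable M" "Y \<in> borel_measurable M"
    and X: "distr M borel X = ?S" and Y: "distr M borel Y = ?S"
    and \<rho>: "correlation M X Y = \<rho>"
    using assms by (auto simp: std_bivariate_normal_def bivariate_normal_def)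
  interpret prob_space M by fact
  obtain \<mu> \<sigma> where "0 \<le> \<sigma>"
    and law: "distr M borel (\<lambda>\<omega>. t * X \<omega> + s * Y \<omega>) = normal_law \<mu> \<sigma>"
    using assms unfolding std_bivariate_normal_def bivariate_normal_def by blast
  note i = integrable_std_normal_low_moments and e = std_normal_low_moments
  have int: "integrable M Z" "integrable M (\<lambda>\<omega>. (Z \<omega>)\<^sup>2)"
    and mean: "(LINT \<omega>|M. Z \<omega>) = 0" "(LINT \<omega>|M. (Z \<omega>)\<^sup>2) = 1"
    if Z: "distr M borel Z = ?S" and [measurable]: "Z \<in> borel_measurable M" for Z
  proof -
    have push: "integrable M (\<lambda>\<omega>. h (Z \<omega>)) = integrable ?S h"
        "(LINT \<omega>|M. h (Z \<omega>)) = (LINT x|?S. h x)"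
      if [measurable]: "h \<in> borel_measurable borel" for h :: "real \<Rightarrow> real"
      unfolding Z [symmetric] by (simp_all add: integrable_distr_eq integral_distr)
    have m: "(\<lambda>x :: real. x) \<in> borel_measurable borel" "(\<lambda>x :: real. x\<^sup>2) \<in> borel_measurable borel" by simp_all
    show "integrable M Z" using push(1)[OF m(1)] i(1) by (rule iffD2)
    show "integrable M (\<lambda>\<omega>. (Z \<omega>)\<^sup>2)" using push(1)[OF m(2)] i(2) by (rule iffD2)
    show "(LINT \<omega>|M. Z \<omega>) = 0" using push(2)[OF m(1)] e(1) by (rule trans)
    show "(LINT \<omega>|M. (Z \<omega>)\<^sup>2) = 1" using push(2)[OF m(2)] e(2) by (rule trans)
  qed
  note [simp] = int[OF X] int[OF Y] mean[OF X] mean[OF Y]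
  have [simp]: "integrable M (\<lambda>\<omega>. X \<omega> * Y \<omega>)"
  proof (rule Bochner_Integration.integrable_bound)
    show "integrable M (\<lambda>\<omega>. (X \<omega>)\<^sup>2 + (Y \<omega>)\<^sup>2)" by simp
    have "\<bar>x * y\<bar> \<le> \<bar>x\<^sup>2 + y\<^sup>2\<bar>" for x y :: real
    proof -
      have "2 * (\<bar>x\<bar> * \<bar>y\<bar>) \<le> x\<^sup>2 + y\<^sup>2"
        using sum_squares_bound[of "\<bar>x\<bar>" "\<bar>y\<bar>"] by (simp add: mult.assoc)
      moreover have "0 \<le> \<bar>x\<bar> * \<bar>y\<bar>" by simp
      ultimately have "\<bar>x\<bar> * \<bar>y\<bar> \<le> x\<^sup>2 + y\<^sup>2" by linarith
      then show ?thesis by (simp add: abs_mult)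
    qed
    then show "AE \<omega> in M. norm (X \<omega> * Y \<omega>) \<le> norm ((X \<omega>)\<^sup>2 + (Y \<omega>)\<^sup>2)" by simp
  qed measurable
  have XY: "(LINT \<omega>|M. X \<omega> * Y \<omega>) = \<rho>"
    using \<rho> by (simp add: correlation_def)
  have "\<mu> = (LINT x|distr M borel (\<lambda>\<omega>. t * X \<omega> + s * Y \<omega>). x)"
    using normal_law_moments[OF \<open>0 \<le> \<sigma>\<close>] law by simp
  also have "\<dots> = 0"
    by (subst integral_distr) auto
  finally have "\<mu> = 0" .
  then have "\<sigma>\<^sup>2 = (LINT x|distr M borel (\<lambda>\<omega>. t * X \<omega> + s * Y \<omega>). x\<^sup>2)"
    using normal_law_moments[OF \<open>0 \<le> \<sigma>\<close>] law by simp
  also have "\<dots> = (LINT \<omega>|M. t\<^sup>2 * (X \<omega>)\<^sup>2 + 2 * (t * s) * (X \<omega> * Y \<omega>) + s\<^sup>2 * (Y \<omega>)\<^sup>2)"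
    by (subst integral_distr) (auto simp: power2_eq_square algebra_simps)
  also have "\<dots> = ?v"
    by (simp add: XY)
  finally have v: "\<sigma>\<^sup>2 = ?v" .
  then show "0 \<le> ?v" by (metis zero_le_power2)
  show "distr M borel (\<lambda>\<omega>. t * X \<omega> + s * Y \<omega>) = normal_law 0 (sqrt ?v)"
    using law \<open>\<mu> = 0\<close> \<open>0 \<le> \<sigma>\<close> by (simp flip: v)
qed

text \<open>
  The variances of \<open>X + Y\<close> and \<open>X - Y\<close>, namely \<open>2 + 2 * \<rho>\<close> and \<open>2 - 2 * \<rho>\<close>, are nonnegative.
\<close>
lemma std_bivariate_normal_abs_correlation_le_1:
  assumes "std_bivariate_normal M X Y \<rho>"
  shows "\<bar>\<rho>\<bar> \<le> 1"
  using std_bivariate_normal_combination(1)[OF assms, of 1 1]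
    std_bivariate_normal_combination(1)[OF assms, of 1 "-1"] by simp

lemma joint_char_std_bivariate_normal:
  assumes "std_bivariate_normal M X Y \<rho>"
  shows "joint_char M X Y t s = complex_of_real (exp (- (t\<^sup>2 + 2 * \<rho> * (t * s) + s\<^sup>2) / 2))"
proof -
  have [measurable]: "X \<in> borel_measurable M" "Y \<in> borel_measurable M"
    using assms by (auto simp: std_bivariate_normal_def bivariate_normal_def)
  have "joint_char M X Y t s = char (distr M borel (\<lambda>\<omega>. t * X \<omega> + s * Y \<omega>)) 1"
    unfolding joint_char_def char_def by (subst integral_distr) auto
  then show ?thesis
    using std_bivariate_normal_combination[OF assms, of t s] by (simp add: char_normal_law)
qed

section \<open>Distance correlation of standard bivariate normal pairs\<close>

lemma dcor_sq_std_bivariate_normal: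
  assumes "std_bivariate_normal M X Y \<rho>"
  shows "dcor_sq M X Y = dcov_profile \<rho> / dcov_profile 1"
proof -
  have XY: "X \<in> borel_measurable M" "Y \<in> borel_measurable M"
    and law: "distr M borel X = std_normal_distribution" "distr M borel Y = std_normal_distribution"
    using assms by (auto simp: std_bivariate_normal_def bivariate_normal_def)
  have self: "dcov_sq M Z Z = 4 / pi * dcov_profile 1"
    if "distr M borel Z = std_normal_distribution" "Z \<in> borel_measurable M" for Z
    using that
    by (intro dcov_sq_gaussian)
       (auto simp: joint_char_self char_std_normal_distribution power2_eq_square algebra_simps)
  have "dcov_sq M X Y = 4 / pi * dcov_profile \<rho>"
    using assms law
    by (intro dcov_sq_gaussian std_bivariate_normal_abs_correlation_le_1 joint_char_std_bivariate_normal) auto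
  moreover have "sqrt (4 / pi * dcov_profile 1 * (4 / pi * dcov_profile 1)) = 4 / pi * dcov_profile 1"
    unfolding real_sqrt_abs2 using dcov_profile_1_pos by simp
  ultimately show ?thesis
    unfolding dcor_sq_def self[OF law(1) XY(1)] self[OF law(2) XY(2)]
    using dcov_profile_1_pos by simp
qed

lemma normal_dcor_over_abs:
  assumes "\<bar>\<rho>\<bar> \<le> 1"
  shows "normal_dcor \<rho> / \<bar>\<rho>\<bar> = sqrt (dcov_profile \<rho> / \<rho>\<^sup>2 / dcov_profile 1)"
proof -
  have "dcor_sq (bvn_law \<rho>) fst snd = dcov_profile \<rho> / dcov_profile 1"
    using assms by (intro dcor_sq_std_bivariate_normal std_bivariate_normal_bvn_law) auto
  then show ?thesis
    by (simp add: normal_dcor_def dcor_def real_sqrt_divide real_sqrt_mult)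
qed

theorem theorem7:
  shows "(\<forall>(M :: 'a measure) X Y \<rho>. std_bivariate_normal M X Y \<rho> \<longrightarrow>
            dcor M X Y \<le> \<bar>\<rho>\<bar> \<and>
            (dcor M X Y)\<^sup>2 =
              (\<rho> * arcsin \<rho> + sqrt (1 - \<rho>\<^sup>2) - \<rho> * arcsin (\<rho> / 2) - sqrt (4 - \<rho>\<^sup>2) + 1)
                / (1 + pi / 3 - sqrt 3)) \<and>
         (INF \<rho>\<in>{-1..1} - {0}. normal_dcor \<rho> / \<bar>\<rho>\<bar>) = 1 / (2 * sqrt (1 + pi / 3 - sqrt 3)) \<and>
         ((\<lambda>\<rho>. normal_dcor \<rho> / \<bar>\<rho>\<bar>) \<longlongrightarrow> 1 / (2 * sqrt (1 + pi / 3 - sqrt 3)))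
           (at 0 within {-1..1}) \<and>
         \<bar>1 / (2 * sqrt (1 + pi / 3 - sqrt 3)) - 0.89066\<bar> < 0.000005"
proof -
  define L where "L = sqrt (1 / 4 / dcov_profile 1)"
  have L: "1 / (2 * sqrt (1 + pi / 3 - sqrt 3)) = L"
    unfolding dcov_profile_1 [symmetric] by (simp add: L_def real_sqrt_divide real_sqrt_mult)
  have dcor: "dcor M X Y \<le> \<bar>\<rho>\<bar> \<and> (dcor M X Y)\<^sup>2 = dcov_profile \<rho> / dcov_profile 1"
    if "std_bivariate_normal M X Y \<rho>" for M :: "'a measure" and X Y \<rho>
  proof -
    have \<rho>: "\<bar>\<rho>\<bar> \<le> 1"
      using that by (rule std_bivariate_normal_abs_correlation_le_1)
    have "sqrt (dcov_profile \<rho> / dcov_profile 1) \<le> sqrt (\<rho>\<^sup>2)"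
      using dcov_profile_le[OF \<rho>] dcov_profile_1_pos
      by (intro real_sqrt_le_mono) (simp add: pos_divide_le_eq)
    then show ?thesis
      using dcov_profile_nonneg[OF \<rho>] dcov_profile_1_pos by (simp add: dcor_def dcor_sq_std_bivariate_normal[OF that])
  qed
  have lim: "((\<lambda>\<rho>. normal_dcor \<rho> / \<bar>\<rho>\<bar>) \<longlongrightarrow> L) (at 0 within {-1..1})"
  proof (rule Lim_transform_eventually)
    show "((\<lambda>\<rho>. sqrt (dcov_profile \<rho> / \<rho>\<^sup>2 / dcov_profile 1)) \<longlongrightarrow> L) (at 0 within {-1..1})"
      unfolding L_def using dcov_profile_1_pos
      by (intro tendsto_intros tendsto_within_subset[OF dcov_profile_over_square_tendsto]) auto
    show "\<forall>\<^sub>F \<rho> in at 0 within {-1..1}. sqrt (dcov_profile \<rho> / \<rho>\<^sup>2 / dcov_profile 1) = normal_dcor \<rho> / \<bar>\<rho>\<bar>"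
      unfolding eventually_at_filter by (auto simp: normal_dcor_over_abs abs_le_iff intro!: always_eventually)
  qed
  have lower: "L \<le> normal_dcor \<rho> / \<bar>\<rho>\<bar>" if "\<rho> \<in> {-1..1} - {0}" for \<rho>
  proof -
    have \<rho>: "\<bar>\<rho>\<bar> \<le> 1" "\<rho> \<noteq> 0"
      using that by auto
    then have "1 / 4 \<le> dcov_profile \<rho> / \<rho>\<^sup>2"
      using dcov_profile_ge[of \<rho>] by (simp add: field_simps)
    then show ?thesis
      unfolding normal_dcor_over_abs[OF \<rho>(1)] L_def using dcov_profile_1_pos
      by (intro real_sqrt_le_mono divide_right_mono) auto
  qed
  have "(INF \<rho>\<in>{-1..1} - {0}. normal_dcor \<rho> / \<bar>\<rho>\<bar>) = L" (is "?inf = L")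
  proof (rule antisym)
    have bdd: "bdd_below ((\<lambda>\<rho>. normal_dcor \<rho> / \<bar>\<rho>\<bar>) ` ({-1..1} - {0}))"
      using lower by (rule bdd_belowI2)
    show "?inf \<le> L"
    proof (rule tendsto_lowerbound[OF lim])
      show "\<forall>\<^sub>F \<rho> in at 0 within {-1..1}. ?inf \<le> normal_dcor \<rho> / \<bar>\<rho>\<bar>"
        unfolding eventually_at_filter using bdd by (auto intro!: always_eventually cINF_lower)
      show "at (0 :: real) within {-1..1} \<noteq> bot"
        by (simp add: at_within_Icc_at)
    qed
    have "1 \<in> {-1..1} - {0 :: real}" by simp
    then have "{-1..1} - {0 :: real} \<noteq> {}" by blast
    then show "L \<le> ?inf"
      using lower by (rule cINF_greatest)
  qed
  with dcor lim limit_constant_approx show ?thesis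
    unfolding L by (auto simp: dcov_profile_1 dcov_profile_def L)
qed

end
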